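(* For all $(\alpha,\beta)\in(0,\frac12)^2$, $$F(\alpha,\beta)\ge f(\min\{\alpha,\beta\}),$$ where $F$ is the relative efficiency of the sequential probability ratio test with asymmetric error bounds, $$F(\alpha,\beta)=\frac{\max\{\mathbb{E}_{-1}[\tau_{\alpha,\beta}],\mathbb{E}_{1}[\tau_{\alpha,\beta}]\}}{T_{\alpha,\beta}}=\frac{\max\{\omega(\alpha,\beta),\omega(\beta,\alpha)\}}{T_{\alpha,\beta}},$$ and $f$ is the relative efficiency in the symmetric case, $$f(\alpha)=\frac{\frac{1-2\alpha}{2}\ln\frac{1-\alpha}{\alpha}}{\left(\Phi^{-1}(\alpha)\right)^2},\qquad \alpha\in(0,\tfrac12).$$
   Context: $\Phi$ is the distribution function of the standard normal distribution and $\Phi^{-1}:(0,1)\to\mathbb{R}$ is its inverse. Let $X_t=\theta t+W_t$ with $W$ a standard Brownian motion, $W_0=0$, and let $\mathbb{P}_a$ (with expectation $\mathbb{E}_a$), $a\in\{-1,1\}$, be the probability measure under which $\theta=a$. One tests $H_1:\theta=1$ against $H_{-1}:\theta=-1$ with a decision variable $d\in\{-1,1\}$ required to satisfy $\mathbb{P}_{-1}(d=1)\le\alpha$ and $\mathbb{P}_1(d=-1)\le\beta$. The smallest deterministic time for which such a test exists is $$T_{\alpha,\beta}=\frac{(\Phi^{-1}(\alpha)+\Phi^{-1}(\beta))^2}{4}.$$ The sequential probability ratio test uses $$\tau_{\alpha,\beta}=\inf\left\{t\ge0:X_t\notin\left(\tfrac12\ln\tfrac{\beta}{1-\alpha},\tfrac12\ln\tfrac{1-\beta}{\alpha}\right)\right\},$$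 and by classical results $\mathbb{E}_{-1}[\tau_{\alpha,\beta}]=\omega(\alpha,\beta)$ and $\mathbb{E}_{1}[\tau_{\alpha,\beta}]=\omega(\beta,\alpha)$, where $$\omega(\alpha,\beta)=\frac12\left(\alpha\ln\frac{\alpha}{1-\beta}+(1-\alpha)\ln\frac{1-\alpha}{\beta}\right).$$ Hence $F$ may be taken to be defined by the second formula in the claim. *)

theory Defs
  imports "HOL-Probability.Probability"
begin

definition Phi :: "real \<Rightarrow> real" where
  "Phi = cdf std_normal_distribution"

(* Meaningful on the open unit interval, which is the range of the injective function Phi. *)
definition Phi_inv :: "real \<Rightarrow> real" where
  "Phi_inv = the_inv Phi"

(* The smallest deterministic observation time for which some decision rule has error
   probabilities at most alpha (under drift -1) and at most beta (under drift 1). *)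
definition T :: "real \<Rightarrow> real \<Rightarrow> real" where
  "T \<alpha> \<beta> = (Phi_inv \<alpha> + Phi_inv \<beta>)\<^sup>2 / 4"

(* The expected duration of the sequential probability ratio test with error bounds alpha, beta
   under drift -1; under drift 1 it is omega with the two arguments exchanged. *)
definition omega :: "real \<Rightarrow> real \<Rightarrow> real" where
  "omega \<alpha> \<beta> = 1/2 * (\<alpha> * ln (\<alpha> / (1 - \<beta>)) + (1 - \<alpha>) * ln ((1 - \<alpha>) / \<beta>))"

definition F :: "real \<Rightarrow> real \<Rightarrow> real" where
  "F \<alpha> \<beta> = max (omega \<alpha> \<beta>) (omega \<beta> \<alpha>) / T \<alpha> \<beta>"

definition f :: "real \<Rightarrow> real" where
  "f \<alpha> = ((1 - 2 * \<alpha>) / 2 * ln ((1 - \<alpha>) / \<alpha>)) / (Phi_inv \<alpha>)\<^sup>2"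

end

theory Submission
  imports Defs "HOL-Real_Asymp.Real_Asymp"
begin

text \<open>
  Put x = - Phi_inv \<alpha> and y = - Phi_inv \<beta> with 0 < y \<le> x, and let q = 2 Phi - 1 and
  L = ln ((1 + q) / (1 - q)). The average of the two values of omega, which bounds their maximum
  from below, factors as (q x + q y) (L x + L y) / 8, while T = (x + y)^2 / 4. By Cauchy--Schwarz
  the numerator is at least (sqrt (q x L x) + sqrt (q y L y))^2 / 8, so it is enough that
  q L / x^2 is nonincreasing in x > 0, that is, that the symmetric efficiency decreases in x.

  With u = x phi x, the derivative is nonpositive iff L \<ge> 2 u q / ((1 - q^2) (q - u)). Both sides
  vanish at 0, and comparing derivatives leaves an inequality between x, phi and q without
  logarithms. It is settled by the Mills ratio bounds for x^2 \<ge> 2, and for x^2 \<le> 2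
  by a monotonicity argument that reduces it to a numerical check at sqrt 2.
\<close>

section \<open>The standard normal distribution function\<close>

lemma std_normal_density_DERIV:
  "(std_normal_density has_real_derivative - x * std_normal_density x) (at x)"
proof -
  have "((\<lambda>t. c * exp (- t\<^sup>2 / 2)) has_real_derivative - x * (c * exp (- x\<^sup>2 / 2))) (at x)" for c
    by (auto intro!: derivative_eq_intros)
  then show ?thesis unfolding std_normal_density_def .
qed

lemma std_normal_density_pos: "0 < std_normal_density x"
  by (simp add: normal_density_pos)

text \<open>Passing from the measure-theoretic cdf to an integral over a compact interval makes the
  fundamental theorem of calculus available for \<open>Phi\<close>.\<close>

lemma Phi_diff_eq_integral:
  assumes "a \<le> b"
  shows "Phi b - Phi a = integral {a..b} std_normal_density"
proof (cases "a = b")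
  case False
  interpret real_distribution std_normal_distribution
    by (rule real_dist_normal_dist)
  have cont: "continuous_on S std_normal_density" for S
    using DERIV_isCont[OF std_normal_density_DERIV] continuous_at_imp_continuous_on by blast
  have "Phi b - Phi a = measure std_normal_distribution {a<..b}"
    unfolding Phi_def using assms False by (intro cdf_diff_eq) auto
  also have "\<dots> = (LINT x | lborel. indicator {a<..b} x *\<^sub>R std_normal_density x)"
    unfolding measure_def
    by (subst emeasure_density, simp, simp, subst integral_eq_nn_integral)
       (auto simp: normal_density_nonneg intro!: arg_cong[where f=enn2real] nn_integral_cong
        split: split_indicator)
  also have "\<dots> = (LINT x | lborel. indicator {a..b} x *\<^sub>R std_normal_density x)"
    by (intro integral_cong_AE, simp, simp, use AE_lborel_singleton[of a] in eventually_elim)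
       (auto split: split_indicator)
  also have "\<dots> = integral {a..b} std_normal_density"
    using set_borel_integral_eq_integral(2)[OF borel_integrable_atLeastAtMost'[OF cont]]
    by (simp add: set_lebesgue_integral_def)
  finally show ?thesis .
qed simp

lemma Phi_DERIV: "(Phi has_real_derivative std_normal_density x) (at x)"
proof -
  have cont: "continuous_on S std_normal_density" for S
    using DERIV_isCont[OF std_normal_density_DERIV] continuous_at_imp_continuous_on by blast
  \<comment> \<open>Starting at \<open>x-1\<close> makes \<open>x\<close> an interior point, so the
    derivative within the interval is a full derivative.\<close>
  have "((\<lambda>t. integral {x-1..t} std_normal_density) has_real_derivative std_normal_density x)
      (at x within {x-1..x+1})"
    by (rule integral_has_real_derivative[OF cont]) auto
  then have "((\<lambda>t. integral {x-1..t} std_normal_density) has_real_derivative std_normal_density x) (at x)"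
    by (subst (asm) at_within_interior) auto
  then have "((\<lambda>t. Phi (x-1) + integral {x-1..t} std_normal_density) has_real_derivative
      std_normal_density x) (at x)"
    by (auto intro!: derivative_eq_intros)
  moreover have "\<forall>\<^sub>F t in nhds x. Phi (x-1) + integral {x-1..t} std_normal_density = Phi t"
    using eventually_nhds_in_open[of "{x-1<..<x+1}" x]
    by (auto elim!: eventually_mono simp: Phi_diff_eq_integral[symmetric])
  ultimately show ?thesis
    by (subst (asm) DERIV_cong_ev) auto
qed

lemmas normal_derivs [derivative_intros] =
  std_normal_density_DERIV[THEN DERIV_chain2] Phi_DERIV[THEN DERIV_chain2]

lemma Phi_tendsto:
  shows Phi_at_top: "(Phi \<longlongrightarrow> 1) at_top" and Phi_at_bot: "(Phi \<longlongrightarrow> 0) at_bot"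
proof -
  interpret real_distribution std_normal_distribution
    by (rule real_dist_normal_dist)
  show "(Phi \<longlongrightarrow> 1) at_top" "(Phi \<longlongrightarrow> 0) at_bot"
    unfolding Phi_def by (rule cdf_lim_at_top_prob cdf_lim_at_bot)+
qed

lemma Phi_strict_mono: "strict_mono Phi"
  by (rule strict_monoI, rule DERIV_pos_imp_increasing) (auto intro: Phi_DERIV std_normal_density_pos)

lemma std_normal_density_minus: "std_normal_density (- x) = std_normal_density x"
  by (simp add: std_normal_density_def)

text \<open>The density is even, so \<open>Phi t + Phi (- t)\<close> has derivative zero; its
  constant value is read off from the limit at infinity.\<close>

lemma Phi_minus: "Phi (- x) = 1 - Phi x"
proof -
  have "((\<lambda>t. Phi t + Phi (- t)) has_real_derivative 0) (at t)" for t
    by (auto intro!: derivative_eq_intros simp: std_normal_density_minus)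
  then obtain c where c: "\<And>t. Phi t + Phi (- t) = c"
    using DERIV_isconst_all[of "\<lambda>t. Phi t + Phi (- t)"] by metis
  have "((\<lambda>t. Phi t + Phi (- t)) \<longlongrightarrow> 1 + 0) at_top"
    by (intro tendsto_intros Phi_at_top filterlim_compose[OF Phi_at_bot] filterlim_uminus_at_bot_at_top)
  then have "c = 1"
    by (simp add: c tendsto_const_iff)
  then show ?thesis
    using c[of x] by simp
qed

lemma Phi_zero: "Phi 0 = 1 / 2"
  using Phi_minus[of 0] by simp

lemma Phi_Phi_inv:
  assumes "0 < p" "p < 1"
  shows "Phi (Phi_inv p) = p"
proof -
  obtain a where a: "Phi a < p"
    using order_tendstoD(2)[OF Phi_at_bot \<open>0 < p\<close>] by (auto simp: eventually_at_bot_linorder)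
  obtain b where b: "p < Phi b"
    using order_tendstoD(1)[OF Phi_at_top \<open>p < 1\<close>] by (auto simp: eventually_at_top_linorder)
  have "a \<le> b"
    using a b strict_mono_less[OF Phi_strict_mono, of a b] by linarith
  then obtain x where "Phi x = p"
    using IVT[of Phi a p b] a b DERIV_isCont[OF Phi_DERIV] by auto
  then show ?thesis
    unfolding Phi_inv_def using strict_mono_imp_inj_on[OF Phi_strict_mono] by (metis the_inv_f_f)
qed

section \<open>Mills ratio bounds for the normal tail\<close>

text \<open>A nonincreasing function stays above its limit at infinity. Each Mills bound applies
  this to the gap between its two sides, normalised so that the tail \<open>1 - Phi\<close> has
  coefficient 1 or -1.\<close>

lemma nonneg_if_DERIV_nonpos_tendsto_zero:
  fixes g :: "real \<Rightarrow> real"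
  assumes "\<And>t. x \<le> t \<Longrightarrow> (g has_real_derivative g' t) (at t)" and "\<And>t. x \<le> t \<Longrightarrow> g' t \<le> 0"
    and "(g \<longlongrightarrow> 0) at_top"
  shows "0 \<le> g x"
proof (rule tendsto_upperbound[OF assms(3)])
  show "\<forall>\<^sub>F t in at_top. g t \<le> g x"
    using eventually_ge_at_top[of x]
  proof eventually_elim
    case (elim t)
    show ?case
      by (rule DERIV_nonpos_imp_nonincreasing[OF elim]) (use assms in force)
  qed
qed simp

lemma std_normal_density_at_top: "(std_normal_density \<longlongrightarrow> 0) at_top"
proof -
  have "((\<lambda>x::real. exp (- x\<^sup>2 / 2)) \<longlongrightarrow> 0) at_top" by real_asymp
  from tendsto_mult_right_zero[OF this] show ?thesis unfolding std_normal_density_def .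
qed

lemma mills_upper:
  assumes "0 < x"
  shows "x * (1 - Phi x) \<le> std_normal_density x"
proof -
  have "0 \<le> std_normal_density x / x - (1 - Phi x)"
  proof (rule nonneg_if_DERIV_nonpos_tendsto_zero
      [where g = "\<lambda>x. std_normal_density x / x - (1 - Phi x)"
        and g' = "\<lambda>t. - std_normal_density t / t\<^sup>2"])
    fix t assume "x \<le> t"
    then show "((\<lambda>x. std_normal_density x / x - (1 - Phi x)) has_real_derivative
        - std_normal_density t / t\<^sup>2) (at t)"
      using assms by (auto intro!: derivative_eq_intros simp: field_simps power2_eq_square)
    show "- std_normal_density t / t\<^sup>2 \<le> 0" by (simp add: normal_density_nonneg)
  next
    have "((\<lambda>x. std_normal_density x / x - (1 - Phi x)) \<longlongrightarrow> 0 - (1 - 1)) at_top"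
      by (intro tendsto_intros Phi_at_top tendsto_divide_0[OF std_normal_density_at_top])
         (auto intro: filterlim_at_top_imp_at_infinity filterlim_ident)
    then show "((\<lambda>x. std_normal_density x / x - (1 - Phi x)) \<longlongrightarrow> 0) at_top" by simp
  qed
  then show ?thesis using assms by (simp add: field_simps)
qed

text \<open>The factor 1 + x^2 is chosen so that, by phi' = -x phi, the derivative of the gap
  collapses to a single term of fixed sign. It never vanishes, so the sign of \<open>x\<close> does
  not matter.\<close>

lemma mills_lower: "x * std_normal_density x \<le> (1 + x\<^sup>2) * (1 - Phi x)"
proof -
  have pos: "0 < 1 + t\<^sup>2" for t :: real by (simp add: add_pos_nonneg)
  have "0 \<le> (1 - Phi x) - x * std_normal_density x / (1 + x\<^sup>2)"
  proof (rule nonneg_if_DERIV_nonpos_tendsto_zero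
      [where g = "\<lambda>x. (1 - Phi x) - x * std_normal_density x / (1 + x\<^sup>2)"
        and g' = "\<lambda>t. - 2 * std_normal_density t / (1 + t\<^sup>2)\<^sup>2"])
    fix t :: real
    show "((\<lambda>x. (1 - Phi x) - x * std_normal_density x / (1 + x\<^sup>2)) has_real_derivative
        - 2 * std_normal_density t / (1 + t\<^sup>2)\<^sup>2) (at t)"
    proof (rule DERIV_cong, (rule derivative_eq_intros refl pos[THEN less_imp_neq, symmetric])+)
      show "0 - std_normal_density t * 1 - ((1 * std_normal_density t + - t * std_normal_density t * 1 * t) * (1 + t\<^sup>2)
          - t * std_normal_density t * (0 + real 2 * (1 * t ^ (2 - Suc 0)))) / ((1 + t\<^sup>2) * (1 + t\<^sup>2))
          = - 2 * std_normal_density t / (1 + t\<^sup>2)\<^sup>2"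
        using pos[of t] by (simp add: divide_simps) (simp add: algebra_simps power2_eq_square)
    qed
    show "- 2 * std_normal_density t / (1 + t\<^sup>2)\<^sup>2 \<le> 0" by (simp add: normal_density_nonneg)
  next
    have "((\<lambda>x::real. x / (1 + x\<^sup>2)) \<longlongrightarrow> 0) at_top" by real_asymp
    from tendsto_mult[OF this std_normal_density_at_top]
    have "((\<lambda>x. x * std_normal_density x / (1 + x\<^sup>2)) \<longlongrightarrow> 0) at_top" by simp
    from tendsto_diff[OF tendsto_diff[OF tendsto_const[of 1] Phi_at_top] this]
    show "((\<lambda>x. (1 - Phi x) - x * std_normal_density x / (1 + x\<^sup>2)) \<longlongrightarrow> 0) at_top" by simp
  qed
  then show ?thesis using pos[of x] by (simp add: field_simps)
qed

section \<open>The symmetric relative efficiency decreases\<close>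

abbreviation phi :: "real \<Rightarrow> real" where
  "phi \<equiv> std_normal_density"

text \<open>For x \<ge> 0 this is the probability that a standard normal variable lies in [-x, x],
  called q in the overview; at x = - \<open>Phi_inv\<close> p it equals 1 - 2p.\<close>

definition mass :: "real \<Rightarrow> real" where
  "mass x = 2 * Phi x - 1"

lemma mass_DERIV [THEN DERIV_chain2, derivative_intros]:
  "(mass has_real_derivative 2 * phi x) (at x)"
  unfolding mass_def by (auto intro!: derivative_eq_intros)

lemma mass_zero: "mass 0 = 0"
  by (simp add: mass_def Phi_zero)

lemma mass_less_one: "mass x < 1"
proof -
  have "Phi x < Phi (x + 1)"
    using Phi_strict_mono by (simp add: strict_mono_less)
  also have "Phi (x + 1) \<le> 1"
    using real_distribution.cdf_bounded_prob[OF real_dist_normal_dist] by (simp add: Phi_def)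
  finally show ?thesis by (simp add: mass_def)
qed

lemma mass_pos: "0 < x \<Longrightarrow> 0 < mass x"
  using strict_monoD[OF Phi_strict_mono, of 0 x] by (simp add: mass_def Phi_zero)

text \<open>The density decreases on [0, x], so its integral over [-x, x] is at least the width
  times the endpoint value. This keeps the later denominators q - u positive.\<close>

lemma mass_ge_phi:
  assumes "0 \<le> x"
  shows "2 * (x * phi x) \<le> mass x"
proof -
  have "mass 0 - 2 * (0 * phi 0) \<le> mass x - 2 * (x * phi x)"
  proof (rule DERIV_nonneg_imp_nondecreasing[OF assms], intro exI conjI)
    fix t :: real
    show "((\<lambda>x. mass x - 2 * (x * phi x)) has_real_derivative 2 * t\<^sup>2 * phi t) (at t)"
      by (auto intro!: derivative_eq_intros simp: power2_eq_square)
  qed (simp add: normal_density_nonneg)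
  then show ?thesis by (simp add: mass_zero)
qed

section \<open>Estimates on the interval up to sqrt 2\<close>

lemma exp_minus_le_Taylor:
  fixes y :: real
  assumes "0 \<le> y"
  shows "exp (- y) \<le> 1 - y + y^2/2 - y^3/6 + y^4/24"
proof -
  obtain t where "exp (- y) = (\<Sum>m<5. (- y) ^ m / fact m) + exp t / fact 5 * (- y) ^ 5"
    using Maclaurin_exp_le[of "- y" 5] by blast
  moreover have "0 \<le> exp t / fact 5 * y ^ 5" using assms by simp
  ultimately show ?thesis
    by (simp add: eval_nat_numeral fact_numeral divide_simps)
qed

text \<open>The polynomial is the termwise integral of the quartic Taylor bound for exp (-y) at y =
  t^2/2.\<close>

lemma mass_le_Taylor:
  assumes "0 \<le> x"
  shows "mass x \<le> 2 * phi 0 * (x - x^3/6 + x^5/40 - x^7/336 + x^9/3456)"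
proof -
  define P where "P t = 2 * phi 0 * (t - t^3/6 + t^5/40 - t^7/336 + t^9/3456)" for t :: real
  have "P 0 - mass 0 \<le> P x - mass x"
  proof (rule DERIV_nonneg_imp_nondecreasing[OF assms], intro exI conjI)
    fix t :: real
    let ?y = "t\<^sup>2 / 2"
    show "((\<lambda>t. P t - mass t) has_real_derivative
      2 * phi 0 * ((1 - ?y + ?y^2/2 - ?y^3/6 + ?y^4/24) - exp (- ?y))) (at t)"
      unfolding P_def
      by (rule DERIV_cong, (rule derivative_eq_intros refl | (simp; fail))+)
         (simp add: std_normal_density_def field_simps power_numeral_reduce)
    show "0 \<le> 2 * phi 0 * ((1 - ?y + ?y^2/2 - ?y^3/6 + ?y^4/24) - exp (- ?y))"
      using exp_minus_le_Taylor[of ?y] by (simp add: normal_density_nonneg)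
  qed
  then show ?thesis by (simp add: P_def mass_zero)
qed

text \<open>Numerical endpoint check. Here \<open>j\<close> is the mean of exp (-t^2/2) over
  [0, sqrt 2]; pulling out \<open>c\<close> squared = 1/(2 pi) leaves an inequality between
  \<open>j\<close>, exp (-1) and pi/2.\<close>

lemma mass_density_bound_at_sqrt2:
  "(mass (sqrt 2))\<^sup>2 / 4 + phi (sqrt 2) * mass (sqrt 2) / sqrt 2 - (phi (sqrt 2))\<^sup>2 \<le> 1 / 4"
proof -
  define c where "c = phi 0"
  define e :: real where "e = exp (- 1)"
  define j where "j = mass (sqrt 2) / (2 * c * sqrt 2)"
  have c: "0 < c" "c\<^sup>2 = 1 / (2 * pi)"
    by (auto simp: c_def std_normal_density_def power_divide)
  have phi: "phi (sqrt 2) = c * e"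
    by (simp add: c_def e_def std_normal_density_def)
  have m: "mass (sqrt 2) = 2 * c * sqrt 2 * j"
    using c by (simp add: j_def)
  have pw: "sqrt 2 ^ 3 = 2 * sqrt 2" "sqrt 2 ^ 5 = 4 * sqrt 2" "sqrt 2 ^ 7 = 8 * sqrt 2"
    "sqrt 2 ^ 9 = 16 * sqrt 2"
    by (simp_all add: power_numeral_reduce)
  have "2 * c * sqrt 2 * j \<le> 2 * c * sqrt 2 * (1 - 1/3 + 1/10 - 1/42 + 1/216)"
    using mass_le_Taylor[of "sqrt 2"] unfolding m pw c_def[symmetric] by (simp add: algebra_simps)
  then have j: "j \<le> 7475/10000"
    using c by (subst (asm) mult_le_cancel_left_pos) auto
  have j0: "0 \<le> j"
    using mass_pos[of "sqrt 2"] c by (simp add: j_def)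
  have e: "0 \<le> e" "e \<le> 3/8"
    using exp_minus_le_Taylor[of 1] by (auto simp: e_def)
  have "2 * j\<^sup>2 + 2 * j * e - e\<^sup>2 \<le> 154/100"
  proof -
    \<comment> \<open>Completing the square confines \<open>e\<close> to one term, so its upper
      bound 3/8 suffices once \<open>j\<close> exceeds 3/8; otherwise the square is simply
      dropped.\<close>
    have "2 * j\<^sup>2 + 2 * j * e - e\<^sup>2 = 3 * j\<^sup>2 - (j - e)\<^sup>2"
      by (simp add: power2_eq_square algebra_simps)
    also have "\<dots> \<le> 154/100"
    proof (cases "j \<le> 3/8")
      case True
      then have "j\<^sup>2 \<le> (3/8)\<^sup>2" using j0 by (intro power_mono) auto
      then have "j\<^sup>2 \<le> 9/64" by (simp add: power2_eq_square)
      then show ?thesis using zero_le_power2[of "j - e"] by linarith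
    next
      case False
      then have "(j - 3/8)\<^sup>2 \<le> (j - e)\<^sup>2" using e by (intro power_mono) auto
      moreover have "j\<^sup>2 \<le> (7475/10000)\<^sup>2" using j j0 by (intro power_mono) auto
      ultimately show ?thesis using j by (simp add: power2_eq_square algebra_simps)
    qed
    finally show ?thesis .
  qed
  also have "154/100 \<le> pi / 2"
    using pi_approx(1) by simp
  finally have "c\<^sup>2 * (2 * j\<^sup>2 + 2 * j * e - e\<^sup>2) \<le> 1 / (2 * pi) * (pi / 2)"
    unfolding c(2) by (intro mult_left_mono) auto
  moreover have "(mass (sqrt 2))\<^sup>2 / 4 + phi (sqrt 2) * mass (sqrt 2) / sqrt 2 - (phi (sqrt 2))\<^sup>2
      = c\<^sup>2 * (2 * j\<^sup>2 + 2 * j * e - e\<^sup>2)"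
    unfolding m phi by (simp add: power2_eq_square algebra_simps)
  ultimately show ?thesis by simp
qed

text \<open>The difference vanishes at 0 and its derivative has the sign of 2 - t^2, which is the
  origin of the threshold sqrt 2.\<close>

lemma mass_le_density_polynomial:
  assumes "0 \<le> x" "x \<le> sqrt 2"
  shows "mass x \<le> 2 * x * (1 + x\<^sup>2) * phi x"
proof -
  have "2 * 0 * (1 + 0\<^sup>2) * phi 0 - mass 0 \<le> 2 * x * (1 + x\<^sup>2) * phi x - mass x"
  proof (rule DERIV_nonneg_imp_nondecreasing[OF assms(1)], intro exI conjI)
    fix t :: real
    assume t: "0 \<le> t" "t \<le> x"
    show "((\<lambda>x. 2 * x * (1 + x\<^sup>2) * phi x - mass x) has_real_derivative
        2 * phi t * t\<^sup>2 * (2 - t\<^sup>2)) (at t)"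
      by (rule DERIV_cong, (rule derivative_eq_intros refl)+)
         (simp add: algebra_simps power2_eq_square)
    have "t\<^sup>2 \<le> 2"
      using t assms power_mono[of t "sqrt 2" 2] by simp
    then show "0 \<le> 2 * phi t * t\<^sup>2 * (2 - t\<^sup>2)" by (simp add: normal_density_nonneg)
  qed
  then show ?thesis by (simp add: mass_zero)
qed

lemma mass_density_bound:
  assumes "0 < x" "x \<le> sqrt 2"
  shows "4 * phi x * (mass x - x * phi x) \<le> x * (1 - (mass x)\<^sup>2)"
proof -
  \<comment> \<open>The claim divided by 4x and rearranged reads k x \<le> 1/4. The derivative of
    \<open>k\<close> has the sign controlled by \<open>mass_le_density_polynomial\<close>, so the
    endpoint sqrt 2 is the worst case.\<close>
  define k where "k t = (mass t)\<^sup>2 / 4 + phi t * mass t / t - (phi t)\<^sup>2" for t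
  have "k x \<le> k (sqrt 2)"
  proof (rule DERIV_nonneg_imp_nondecreasing[OF assms(2)], intro exI conjI)
    fix t :: real
    assume t: "x \<le> t" "t \<le> sqrt 2"
    show "(k has_real_derivative phi t / t\<^sup>2 * (2 * t * (1 + t\<^sup>2) * phi t - mass t)) (at t)"
    proof -
      have t0: "t \<noteq> 0" using t assms by simp
      show ?thesis
        unfolding k_def
        by (rule DERIV_cong, (rule derivative_eq_intros t0 refl | (simp; fail))+)
           (use t0 in \<open>simp add: field_simps power2_eq_square\<close>)
    qed
    show "0 \<le> phi t / t\<^sup>2 * (2 * t * (1 + t\<^sup>2) * phi t - mass t)"
      using mass_le_density_polynomial[of t] t assms by (simp add: normal_density_nonneg)
  qed
  also have "k (sqrt 2) \<le> 1 / 4"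
    unfolding k_def by (rule mass_density_bound_at_sqrt2)
  finally show ?thesis
    using assms(1) by (simp add: k_def field_simps power2_eq_square)
qed

text \<open>
  The right-hand side minus the left-hand side is, up to a positive factor, the derivative of
  L - 2 u q / ((1 - q^2) (q - u)). For x > sqrt 2 the upper Mills bound enters as 1 - q \<le> u.
\<close>

lemma log_odds_bound_slope_nonneg:
  assumes "0 < x"
  defines "q \<equiv> mass x" and "u \<equiv> x * phi x"
  shows "4 * u * q\<^sup>2 * (q - u) \<le> (1 - q\<^sup>2) * ((q - 2 * u)\<^sup>2 + q\<^sup>2 * x\<^sup>2)"
proof -
  have q: "0 < q" "q < 1" using mass_pos mass_less_one assms by auto
  have u: "0 < u" "2 * u \<le> q" using mass_ge_phi[of x] assms by (auto simp: normal_density_pos)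
  have q2: "q\<^sup>2 < 1" using q by (simp add: power_less_one_iff)
  show ?thesis
  proof (cases "x \<le> sqrt 2")
    case True
    \<comment> \<open>On this range the square of q - 2u can be discarded.\<close>
    have "4 * u * q\<^sup>2 * (q - u) = (4 * phi x * (q - u)) * (q\<^sup>2 * x)"
      by (simp add: u_def)
    also have "\<dots> \<le> (x * (1 - q\<^sup>2)) * (q\<^sup>2 * x)"
      using mass_density_bound[OF assms(1) True] assms(1)
      by (intro mult_right_mono) (auto simp: q_def u_def)
    also have "\<dots> = (1 - q\<^sup>2) * (q\<^sup>2 * x\<^sup>2)"
      by (simp add: power2_eq_square)
    also have "\<dots> \<le> (1 - q\<^sup>2) * ((q - 2 * u)\<^sup>2 + q\<^sup>2 * x\<^sup>2)"
      using q2 by (intro mult_left_mono) auto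
    finally show ?thesis .
  next
    case False
    define s where "s = x\<^sup>2"
    have s: "2 \<le> s" using False power_mono[of "sqrt 2" x 2] by (simp add: s_def)
    define P where "P = (q - 2 * u)\<^sup>2 + q\<^sup>2 * s"
    have lower: "2 * u \<le> (1 + s) * (1 - q)"
    proof -
      have "(1 + s) * (1 - q) = 2 * ((1 + x\<^sup>2) * (1 - Phi x))"
        by (simp add: q_def s_def mass_def algebra_simps)
      then show ?thesis using mills_lower[of x] by (simp add: u_def)
    qed
    have "s * (1 - q) = 2 * (x * (x * (1 - Phi x)))"
      by (simp add: s_def q_def mass_def power2_eq_square)
    also have "\<dots> \<le> 2 * u"
      using mills_upper[OF assms(1)] assms(1) by (simp add: u_def)
    finally have "s * (1 - q) \<le> 2 * u" .
    moreover have "2 * (1 - q) \<le> s * (1 - q)" using s q by (intro mult_right_mono) auto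
    ultimately have wu: "1 - q \<le> u" by simp
    have P: "P = (1 + s) * q\<^sup>2 - 4 * u * (q - u)"
      by (simp add: P_def power2_eq_square algebra_simps)
    have "(q - u) * (1 + q) \<le> (q - u) * 2"
      using q u by (intro mult_left_mono) auto
    also have "q - u \<le> q\<^sup>2"
    proof -
      have "q * (1 - q) \<le> 1 * (1 - q)" using q by (intro mult_right_mono) auto
      then show ?thesis using wu by (simp add: power2_eq_square algebra_simps)
    qed
    finally have A: "4 * u * ((q - u) * (1 + q)) \<le> 4 * u * (2 * q\<^sup>2)"
      using u by (intro mult_left_mono) auto
    \<comment> \<open>Since s \<ge> 2, the constant 4 is at most 2 + s = 1 + (1 + s); the lower
      Mills bound then replaces the summand 2u.\<close>
    have "4 * u * (2 * q\<^sup>2) \<le> q\<^sup>2 * (2 * u * (2 + s))"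
      using u s q by (simp add: algebra_simps)
    also have "\<dots> \<le> q\<^sup>2 * ((1 + s) * (1 - q) + 2 * (1 + s) * u)"
      using lower by (intro mult_left_mono) (auto simp: algebra_simps)
    finally have "4 * u * ((q - u) * (1 + q)) \<le> q\<^sup>2 * ((1 + s) * (1 - q) + 2 * (1 + s) * u)"
      using A by linarith
    then have main: "2 * (1 + s) * q\<^sup>2 * (q - u) \<le> (1 + q) * P"
      unfolding P by (simp add: algebra_simps power2_eq_square)
    have "0 \<le> P" unfolding P_def using s by simp
    \<comment> \<open>After multiplying by 1 + s, \<open>main\<close> absorbs q - u and a second use
      of the lower Mills bound trades 2u for (1 + s)(1 - q), which produces the factor 1 -
      q^2.\<close>
    have "(1 + s) * (4 * u * q\<^sup>2 * (q - u)) = 2 * u * (2 * (1 + s) * q\<^sup>2 * (q - u))"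
      by (simp add: algebra_simps)
    also have "\<dots> \<le> 2 * u * ((1 + q) * P)"
      using main u by (intro mult_left_mono) auto
    also have "\<dots> \<le> ((1 + s) * (1 - q)) * ((1 + q) * P)"
      using lower q \<open>0 \<le> P\<close> by (intro mult_right_mono) auto
    also have "\<dots> = (1 + s) * ((1 - q\<^sup>2) * P)"
      by (simp add: algebra_simps power2_eq_square)
    finally show ?thesis
      using s by (subst (asm) mult_le_cancel_left_pos) (auto simp: P_def s_def)
  qed
qed

section \<open>The log-odds inequality and monotonicity of the efficiency\<close>

text \<open>This is L of the overview, that is 2 artanh q. Keeping two logarithms makes
  differentiation direct.\<close>

definition log_odds :: "real \<Rightarrow> real" where
  "log_odds x = ln (1 + mass x) - ln (1 - mass x)"

lemma mass_nonneg: "0 \<le> x \<Longrightarrow> 0 \<le> mass x"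
  using mass_pos[of x] mass_zero by (cases "x = 0") auto

lemma mass_sq_less_one: "0 \<le> x \<Longrightarrow> (mass x)\<^sup>2 < 1"
  using mass_nonneg[of x] mass_less_one[of x] by (simp add: abs_square_less_1)

lemma log_odds_DERIV:
  assumes "0 \<le> x"
  shows "(log_odds has_real_derivative 4 * phi x / (1 - (mass x)\<^sup>2)) (at x)"
proof -
  have m: "0 < 1 + mass x" "0 < 1 - mass x" using mass_nonneg[OF assms] mass_less_one[of x] by auto
  have "1 - (mass x)\<^sup>2 = (1 + mass x) * (1 - mass x)"
    by (simp add: power2_eq_square algebra_simps)
  moreover have "(log_odds has_real_derivative
      2 * phi x / (1 + mass x) + 2 * phi x / (1 - mass x)) (at x)"
    unfolding log_odds_def using m by (auto intro!: derivative_eq_intros)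
  moreover have "2 * phi x / (1 + mass x) + 2 * phi x / (1 - mass x)
      = 4 * phi x / ((1 + mass x) * (1 - mass x))"
    using m by (simp add: add_frac_eq algebra_simps)
  ultimately show ?thesis by simp
qed

lemma log_odds_nonneg: "0 \<le> x \<Longrightarrow> 0 \<le> log_odds x"
  using mass_nonneg[of x] mass_less_one[of x] by (simp add: log_odds_def)

lemma mass_minus_pos: "0 < x \<Longrightarrow> 0 < mass x - x * phi x"
  using mass_ge_phi[of x] mass_pos[of x] by linarith

text \<open>Differentiation removes the logarithm; the sign of the numerator is exactly
  \<open>log_odds_bound_slope_nonneg\<close>.\<close>

lemma log_odds_bound_DERIV:
  assumes "0 < x"
  defines "q \<equiv> mass x" and "u \<equiv> x * phi x"
  shows "((\<lambda>x. log_odds x - 2 * (x * phi x * mass x / ((1 - (mass x)\<^sup>2) * (mass x - x * phi x))))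
    has_real_derivative
      2 * phi x * ((1 - q\<^sup>2) * ((q - 2 * u)\<^sup>2 + q\<^sup>2 * x\<^sup>2) - 4 * u * q\<^sup>2 * (q - u))
      / ((1 - q\<^sup>2) * (q - u))\<^sup>2) (at x)"
proof -
  define p where "p = phi x"
  define M where "M = 1 - q\<^sup>2"
  have nz: "M \<noteq> 0" "q - u \<noteq> 0"
    using mass_sq_less_one[of x] mass_minus_pos[of x] assms by (auto simp: M_def)
  have N: "((\<lambda>x. x * phi x * mass x) has_real_derivative p * (1 - x\<^sup>2) * q + 2 * u * p) (at x)"
    by (auto intro!: derivative_eq_intros simp: p_def q_def u_def power2_eq_square algebra_simps)
  have D: "((\<lambda>x. (1 - (mass x)\<^sup>2) * (mass x - x * phi x)) has_real_derivative
      - 4 * q * p * (q - u) + M * (p * (1 + x\<^sup>2))) (at x)"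
    by (auto intro!: derivative_eq_intros
        simp: p_def q_def u_def M_def power2_eq_square algebra_simps)
  have D0: "(1 - (mass x)\<^sup>2) * (mass x - x * phi x) \<noteq> 0"
    using nz by (simp add: M_def q_def u_def)
  have "4 * p / M - 2 * (((p * (1 - x\<^sup>2) * q + 2 * u * p) * (M * (q - u))
        - u * q * (- 4 * q * p * (q - u) + M * (p * (1 + x\<^sup>2)))) / (M * (q - u) * (M * (q - u))))
      = 2 * p * (M * ((q - 2 * u)\<^sup>2 + q\<^sup>2 * x\<^sup>2) - 4 * u * q\<^sup>2 * (q - u)) / (M * (q - u))\<^sup>2"
  proof -
    have "4 * p / M - 2 * (Z / (M * (q - u) * (M * (q - u))))
        = (4 * p * M * (q - u)\<^sup>2 - 2 * Z) / (M * (q - u))\<^sup>2" for Z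
      using nz by (simp add: diff_divide_distrib power2_eq_square)
    moreover have "4 * p * M * (q - u)\<^sup>2 - 2 * ((p * (1 - x\<^sup>2) * q + 2 * u * p) * (M * (q - u))
        - u * q * (- 4 * q * p * (q - u) + M * (p * (1 + x\<^sup>2))))
      = 2 * p * (M * ((q - 2 * u)\<^sup>2 + q\<^sup>2 * x\<^sup>2) - 4 * u * q\<^sup>2 * (q - u))"
      by (simp add: power2_eq_square algebra_simps)
    ultimately show ?thesis by (simp only:)
  qed
  then show ?thesis
    using DERIV_diff[OF log_odds_DERIV[of x] DERIV_cmult[OF DERIV_divide[OF N D D0], of 2]] assms(1)
    by (simp add: p_def M_def q_def u_def)
qed

text \<open>The difference of the two sides, divided by the positive factor of L, is nondecreasing
  with nonnegative limit at 0 from the right. As \<open>R\<close> has the form 0/0 at 0, the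
  comparison starts at e > 0 and lets e tend to 0.\<close>

lemma log_odds_ge:
  assumes "0 < x"
  shows "2 * (x * phi x * mass x) \<le> (1 - (mass x)\<^sup>2) * (mass x - x * phi x) * log_odds x"
proof -
  define R where "R x = x * phi x * mass x / ((1 - (mass x)\<^sup>2) * (mass x - x * phi x))" for x
  have mono: "log_odds e - 2 * R e \<le> log_odds x - 2 * R x" if "0 < e" "e \<le> x" for e
  proof (rule DERIV_nonneg_imp_nondecreasing[OF that(2)])
    fix t assume "e \<le> t" "t \<le> x"
    then have "0 < t" using that by simp
    from log_odds_bound_slope_nonneg[OF this] log_odds_bound_DERIV[OF this]
    show "\<exists>y. ((\<lambda>x. log_odds x - 2 * R x) has_real_derivative y) (at t) \<and> 0 \<le> y"
      unfolding R_def by (intro exI conjI) (auto simp: normal_density_nonneg)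
  qed
  \<comment> \<open>By \<open>mass_ge_phi\<close> the quotient q/(q - u) is at most 2, which gives a
    lower bound that is continuous at 0.\<close>
  have lower: "- 4 * (e * phi e) / (1 - (mass e)\<^sup>2) \<le> log_odds x - 2 * R x" if "0 < e" "e \<le> x" for e
  proof -
    have m: "0 < 1 - (mass e)\<^sup>2" "0 < mass e - e * phi e" "mass e \<le> 2 * (mass e - e * phi e)"
      using mass_sq_less_one[of e] mass_minus_pos[of e] mass_ge_phi[of e] that by auto
    have "R e = e * phi e / (1 - (mass e)\<^sup>2) * (mass e / (mass e - e * phi e))"
      by (simp add: R_def)
    also have "\<dots> \<le> e * phi e / (1 - (mass e)\<^sup>2) * 2"
      using m that by (intro mult_left_mono) (auto simp: divide_simps normal_density_nonneg)
    finally show ?thesis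
      using mono[OF that] log_odds_nonneg[of e] that by simp
  qed
  have "isCont (\<lambda>e. - 4 * (e * phi e) / (1 - (mass e)\<^sup>2)) 0"
    using DERIV_isCont[OF mass_DERIV[OF DERIV_ident]] DERIV_isCont[OF std_normal_density_DERIV]
    by (intro continuous_intros) (auto simp: mass_zero)
  then have "((\<lambda>e. - 4 * (e * phi e) / (1 - (mass e)\<^sup>2)) \<longlongrightarrow> 0) (at_right 0)"
    by (auto simp: isCont_def mass_zero intro: tendsto_within_subset)
  moreover have "\<forall>\<^sub>F e in at_right 0. - 4 * (e * phi e) / (1 - (mass e)\<^sup>2) \<le> log_odds x - 2 * R x"
    using eventually_at_right_real[OF assms] by eventually_elim (use lower in auto)
  ultimately have "0 \<le> log_odds x - 2 * R x"
    by (rule tendsto_upperbound) simp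
  moreover have "0 < (1 - (mass x)\<^sup>2) * (mass x - x * phi x)"
    using mass_sq_less_one[of x] mass_minus_pos[of x] assms by simp
  ultimately show ?thesis
    by (simp add: R_def field_simps)
qed

text \<open>By the quotient rule, \<open>log_odds_ge\<close> is the sign condition on the
  derivative. At x = - \<open>Phi_inv\<close> p the quantity is 2 \<open>f\<close> p.\<close>

lemma efficiency_decreasing:
  assumes "0 < y" "y \<le> x"
  shows "mass x * log_odds x / x\<^sup>2 \<le> mass y * log_odds y / y\<^sup>2"
proof (rule DERIV_nonpos_imp_nonincreasing[OF assms(2)], intro exI conjI)
  fix t assume t: "y \<le> t" "t \<le> x"
  then have t0: "0 < t" using assms by simp
  define M where "M = 1 - (mass t)\<^sup>2"
  have M: "0 < M" using mass_sq_less_one[of t] t0 by (simp add: M_def)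
  show "((\<lambda>x. mass x * log_odds x / x\<^sup>2) has_real_derivative
      2 / (t ^ 3 * M) * (2 * (t * phi t * mass t) - M * (mass t - t * phi t) * log_odds t)) (at t)"
  proof -
    have "((\<lambda>x. mass x * log_odds x / x\<^sup>2) has_real_derivative
        ((2 * phi t * log_odds t + 4 * phi t / M * mass t) * t\<^sup>2
          - mass t * log_odds t * (2 * t)) / (t\<^sup>2 * t\<^sup>2)) (at t)"
    proof (rule DERIV_divide)
      show "((\<lambda>x. mass x * log_odds x) has_real_derivative
          2 * phi t * log_odds t + 4 * phi t / M * mass t) (at t)"
        using DERIV_mult[OF mass_DERIV[OF DERIV_ident] log_odds_DERIV[of t]] t0
        by (simp add: M_def)
      show "((\<lambda>x. x\<^sup>2) has_real_derivative 2 * t) (at t)"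
        by (auto intro!: derivative_eq_intros)
    qed (use t0 in simp)
    then show ?thesis
      by (rule DERIV_cong) (use M t0 in \<open>simp add: field_simps power2_eq_square power3_eq_cube\<close>)
  qed
  show "2 / (t ^ 3 * M) * (2 * (t * phi t * mass t) - M * (mass t - t * phi t) * log_odds t) \<le> 0"
    using log_odds_ge[OF t0] M t0 by (intro mult_nonneg_nonpos) (auto simp: M_def)
qed

text \<open>Cauchy-Schwarz for (sqrt a, sqrt c) and (sqrt b, sqrt d), by the arithmetic-geometric
  mean inequality on the cross terms.\<close>

lemma sqrt_mult_sum_le:
  fixes a b c d :: real
  assumes "0 \<le> a" "0 \<le> b" "0 \<le> c" "0 \<le> d"
  shows "(sqrt (a * b) + sqrt (c * d))\<^sup>2 \<le> (a + c) * (b + d)"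
proof -
  have "2 * (sqrt (a * d) * sqrt (b * c)) \<le> a * d + b * c"
    using sum_squares_bound[of "sqrt (a * d)" "sqrt (b * c)"] assms by simp
  moreover have "sqrt (a * d) * sqrt (b * c) = sqrt (a * b) * sqrt (c * d)"
    by (simp add: real_sqrt_mult)
  ultimately show ?thesis
    using assms by (simp add: power2_sum algebra_simps)
qed

text \<open>With \<open>h\<close> the value at the larger point, q L equals h x^2 at
  \<open>x\<close> and is at least h y^2 at \<open>y\<close>; Cauchy-Schwarz combines the two square
  roots into h (x + y)^2.\<close>

lemma mean_efficiency_ge:
  assumes "0 < y" "y \<le> x"
  shows "mass x * log_odds x / x\<^sup>2 \<le> (mass x + mass y) * (log_odds x + log_odds y) / (x + y)\<^sup>2"
proof -
  define h where "h = mass x * log_odds x / x\<^sup>2"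
  have x: "0 < x" using assms by simp
  have nonneg: "0 \<le> mass x" "0 \<le> log_odds x" "0 \<le> mass y" "0 \<le> log_odds y"
    using assms mass_nonneg log_odds_nonneg by auto
  have h: "0 \<le> h" using nonneg by (simp add: h_def)
  have "mass x * log_odds x = h * x\<^sup>2" using x by (simp add: h_def)
  then have sx: "sqrt (mass x * log_odds x) = sqrt h * x"
    using x by (simp add: real_sqrt_mult)
  have "h * y\<^sup>2 \<le> mass y * log_odds y"
    using efficiency_decreasing[OF assms] assms(1) by (simp add: h_def pos_le_divide_eq)
  then have "sqrt (h * y\<^sup>2) \<le> sqrt (mass y * log_odds y)" by simp
  then have sy: "sqrt h * y \<le> sqrt (mass y * log_odds y)"
    using assms(1) by (simp add: real_sqrt_mult)
  have "h * (x + y)\<^sup>2 = (sqrt h * x + sqrt h * y)\<^sup>2"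
    using h by (simp add: power_mult_distrib distrib_left[symmetric])
  also have "\<dots> \<le> (sqrt (mass x * log_odds x) + sqrt (mass y * log_odds y))\<^sup>2"
    unfolding sx using sy h x assms by (intro power_mono) auto
  also have "\<dots> \<le> (mass x + mass y) * (log_odds x + log_odds y)"
    by (rule sqrt_mult_sum_le) (use nonneg in auto)
  finally show ?thesis
    using assms by (simp add: h_def[symmetric] pos_le_divide_eq)
qed

section \<open>The asymmetric test\<close>

text \<open>Each of the four logarithms acquires the coefficient 1 - \<alpha> - \<beta> up to sign
  and the factor 1/2, so the sum factors although neither summand does.\<close>

lemma omega_add:
  assumes "0 < \<alpha>" "\<alpha> < 1" "0 < \<beta>" "\<beta> < 1"
  shows "omega \<alpha> \<beta> + omega \<beta> \<alpha>
    = (1 - \<alpha> - \<beta>) / 2 * (ln ((1 - \<alpha>) / \<alpha>) + ln ((1 - \<beta>) / \<beta>))"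
proof -
  have "omega \<alpha> \<beta> = 1/2 * (\<alpha> * (ln \<alpha> - ln (1 - \<beta>)) + (1 - \<alpha>) * (ln (1 - \<alpha>) - ln \<beta>))"
    and "omega \<beta> \<alpha> = 1/2 * (\<beta> * (ln \<beta> - ln (1 - \<alpha>)) + (1 - \<beta>) * (ln (1 - \<beta>) - ln \<alpha>))"
    and "ln ((1 - \<alpha>) / \<alpha>) = ln (1 - \<alpha>) - ln \<alpha>" and "ln ((1 - \<beta>) / \<beta>) = ln (1 - \<beta>) - ln \<beta>"
    using assms by (auto simp only: omega_def intro!: arg_cong2[of _ _ _ _ "(*)"] arg_cong2[of _ _ _ _ "(+)"] ln_divide_pos)
  then show ?thesis
    by (simp only:) (simp add: field_simps)
qed

text \<open>Dictionary from error levels to points on the positive axis; the minus sign compensates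
  for p < 1/2.\<close>

lemma Phi_inv_eq_mass:
  assumes "0 < p" "p < 1/2"
  defines "x \<equiv> - Phi_inv p"
  shows "0 < x" "1 - 2 * p = mass x" "ln ((1 - p) / p) = log_odds x"
proof -
  have "Phi (- x) = p" using Phi_Phi_inv assms by simp
  then have Phi: "Phi x = 1 - p" by (simp add: Phi_minus)
  then show m: "1 - 2 * p = mass x" by (simp add: mass_def)
  have "Phi 0 < Phi x" using Phi assms by (simp add: Phi_zero)
  then show "0 < x" using strict_mono_less[OF Phi_strict_mono] by blast
  have "1 + mass x = 2 * (1 - p)" "1 - mass x = 2 * p" using m by simp_all
  then have "log_odds x = ln (2 * (1 - p)) - ln (2 * p)" by (simp only: log_odds_def)
  also have "\<dots> = ln ((2 * (1 - p)) / (2 * p))"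
    using assms(1,2) by (intro ln_divide_pos[symmetric]) auto
  also have "(2 * (1 - p)) / (2 * p) = (1 - p) / p" by (rule mult_divide_mult_cancel_left) simp
  finally show "ln ((1 - p) / p) = log_odds x" ..
qed

lemma F_commute: "F \<alpha> \<beta> = F \<beta> \<alpha>"
  by (simp add: F_def T_def max.commute add.commute)

lemma f_le_F:
  assumes "0 < \<alpha>" "\<alpha> \<le> \<beta>" "\<beta> < 1/2"
  shows "f \<alpha> \<le> F \<alpha> \<beta>"
proof -
  define x where "x = - Phi_inv \<alpha>"
  define y where "y = - Phi_inv \<beta>"
  have xa: "0 < x" "1 - 2 * \<alpha> = mass x" "ln ((1 - \<alpha>) / \<alpha>) = log_odds x"
    and yb: "0 < y" "1 - 2 * \<beta> = mass y" "ln ((1 - \<beta>) / \<beta>) = log_odds y"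
    using Phi_inv_eq_mass[of \<alpha>] Phi_inv_eq_mass[of \<beta>] assms by (auto simp: x_def y_def)
  \<comment> \<open>The smaller error level corresponds to the larger point, as
    \<open>mean_efficiency_ge\<close> requires.\<close>
  have "Phi y \<le> Phi x" using xa(2) yb(2) assms(2) by (simp add: mass_def)
  then have yx: "y \<le> x" using strict_mono_less_eq[OF Phi_strict_mono] by blast
  have T: "T \<alpha> \<beta> = (x + y)\<^sup>2 / 4"
    by (simp add: T_def x_def y_def power2_eq_square algebra_simps)
  have "f \<alpha> = 1 / 2 * (mass x * log_odds x / x\<^sup>2)"
    unfolding f_def xa(2,3) by (simp add: x_def)
  also have "\<dots> \<le> 1 / 2 * ((mass x + mass y) * (log_odds x + log_odds y) / (x + y)\<^sup>2)"
    using mean_efficiency_ge[OF yb(1) yx] by (intro mult_left_mono) auto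
  also have "\<dots> = (omega \<alpha> \<beta> + omega \<beta> \<alpha>) / 2 / T \<alpha> \<beta>"
  proof -
    have "1 - \<alpha> - \<beta> = (mass x + mass y) / 2"
      by (simp add: xa(2)[symmetric] yb(2)[symmetric])
    moreover have "omega \<alpha> \<beta> + omega \<beta> \<alpha> = (1 - \<alpha> - \<beta>) / 2 * (log_odds x + log_odds y)"
      using omega_add[of \<alpha> \<beta>] assms by (simp only: xa(3) yb(3))
    ultimately have "omega \<alpha> \<beta> + omega \<beta> \<alpha> = (mass x + mass y) / 2 / 2 * (log_odds x + log_odds y)"
      by (simp only:)
    then show ?thesis by (simp only: T) simp
  qed
  \<comment> \<open>The maximum dominates the mean, and \<open>T\<close> is nonnegative.\<close>
  also have "\<dots> \<le> F \<alpha> \<beta>"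
    unfolding F_def by (intro divide_right_mono) (auto simp: T)
  finally show ?thesis .
qed

theorem theorem4p1:
  fixes \<alpha> \<beta> :: real
  assumes "\<alpha> \<in> {0<..<1/2}" and "\<beta> \<in> {0<..<1/2}"
  shows "F \<alpha> \<beta> \<ge> f (min \<alpha> \<beta>)"
  using assms f_le_F[of \<alpha> \<beta>] f_le_F[of \<beta> \<alpha>] F_commute[of \<alpha> \<beta>]
  by (cases "\<alpha> \<le> \<beta>") (auto simp: min_def)

end
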